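(* Let $X_0 \subset \mathbb{R}^n$, $f:\mathbb{R}^n \times \mathbb{R}^{m_u} \times \mathbb{R}^{m_w} \to \mathbb{R}^n$, $T>0$, $Y \subset \mathbb{R}^{m_u}$ and $\gamma \ge 0$, and assume that solutions of the ODE $\dot x(t)=f(x(t),u(t),w(t))$ exist and are unique (so that the solution map $\phi_f$ is well defined). Let $X_c \subset \mathbb{R}^n$ be any set such that $FR(X_0,f,t,Y,\gamma) \subseteq X_c$ for all $t \in [0,T]$. Suppose there exists a differentiable function $V: \mathbb{R}^n \times \mathbb{R} \to \mathbb{R}$ such that $$V(x,0) \le 1 \quad \text{for all } x \in X_0,$$ $$\frac{\partial V}{\partial t}(x,t) + \nabla_x V(x,t)^T f(x,u,w) \le w^T w \quad \text{for all } x \in X_c,\ t \in [0,T],\ u \in Y,\ w \in \mathbb{R}^{m_w}.$$ Then $FR(X_0,f,T,Y,\gamma) \subseteq \{x \in \mathbb{R}^n : V(x,T) \le 1+\gamma\}$.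
   Context: For $\tau>0$, $L_2^m[0,\tau]$ denotes the set of (measurable) functions $g:\mathbb{R}\to\mathbb{R}^m$ with $\int_0^\tau g(t)^Tg(t)\,dt<\infty$. For a horizon $\tau>0$, $Y\subset\mathbb{R}^{m_u}$ and $\gamma\ge 0$, the admissible input sets are $U_Y=\{u\in L_2^{m_u}[0,\tau]: u(t)\in Y \text{ for all } t\in[0,\tau]\}$ and $W_\gamma=\{w\in L_2^{m_w}[0,\tau]: \int_0^\tau w(t)^Tw(t)\,dt<\gamma\}$. Solution map: for an initial condition $x\in\mathbb{R}^n$ and inputs $u\in L_2^{m_u}[0,\tau]$, $w\in L_2^{m_w}[0,\tau]$, $\phi_f(x,u,w,\cdot)$ denotes the solution on $[0,\tau]$ of $\frac{\partial}{\partial t}\phi_f(x,u,w,t)=f(\phi_f(x,u,w,t),u(t),w(t))$ with $\phi_f(x,u,w,0)=x$; since inputs are only $L_2$ functions of time, this is understood as an absolutely continuous function satisfying the equation for almost every $t$. Existence and uniqueness of solution maps is a standing assumption. Forward reachable set: for $X_0\subset\mathbb{R}^n$ and $\tau>0$, $FR(X_0,f,\tau,Y,\gamma)=\{y\in\mathbb{R}^n: \exists x\in X_0,\ u\in U_Y,\ w\in W_\gamma \text{ such that } \phi_f(x,u,w,\tau)=y\}$, with $U_Y$, $W_\gamma$ taken with horizon $\tau$. For $\tau=0$ the reachable set is $X_0$. $\nabla_x V=(\partial V/\partial x_1,\dots,\partial V/\partial x_n)$. *)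

theory Defs
  imports "HOL-Analysis.Analysis"
begin

definition L2_on :: "real \<Rightarrow> (real \<Rightarrow> real ^ 'm) set" where
  "L2_on \<tau> = {g. g \<in> borel_measurable lebesgue \<and>
                   set_integrable lebesgue {0..\<tau>} (\<lambda>t. g t \<bullet> g t)}"

definition input_U :: "real \<Rightarrow> (real ^ 'mu) set \<Rightarrow> (real \<Rightarrow> real ^ 'mu) set" where
  "input_U \<tau> Y = {u \<in> L2_on \<tau>. \<forall>t\<in>{0..\<tau>}. u t \<in> Y}"

definition input_W :: "real \<Rightarrow> real \<Rightarrow> (real \<Rightarrow> real ^ 'mw) set" where
  "input_W \<tau> \<gamma> = {w \<in> L2_on \<tau>. (LINT t:{0..\<tau>}|lebesgue. w t \<bullet> w t) < \<gamma>}"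

text \<open>Absolute continuity on \<open>[a, b]\<close>: a finite family of nonoverlapping subintervals
  \<open>[s, t]\<close> is a finite set of pairs \<open>(s, t)\<close>.\<close>

definition abs_cont_on :: "real \<Rightarrow> real \<Rightarrow> (real \<Rightarrow> 'a::real_normed_vector) \<Rightarrow> bool" where
  "abs_cont_on a b \<xi> \<longleftrightarrow>
     (\<forall>\<epsilon>>0. \<exists>\<delta>>0. \<forall>D. finite D \<longrightarrow>
        (\<forall>(s, t)\<in>D. a \<le> s \<and> s \<le> t \<and> t \<le> b) \<longrightarrow>
        disjoint_family_on (\<lambda>(s, t). {s<..<t}) D \<longrightarrow>
        (\<Sum>(s, t)\<in>D. t - s) < \<delta> \<longrightarrow>
        (\<Sum>(s, t)\<in>D. norm (\<xi> t - \<xi> s)) < \<epsilon>)"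

definition ode_solution ::
  "(real ^ 'n \<Rightarrow> real ^ 'mu \<Rightarrow> real ^ 'mw \<Rightarrow> real ^ 'n) \<Rightarrow> real \<Rightarrow> real ^ 'n \<Rightarrow>
   (real \<Rightarrow> real ^ 'mu) \<Rightarrow> (real \<Rightarrow> real ^ 'mw) \<Rightarrow> (real \<Rightarrow> real ^ 'n) \<Rightarrow> bool" where
  "ode_solution f \<tau> x u w \<xi> \<longleftrightarrow>
     \<xi> 0 = x \<and> abs_cont_on 0 \<tau> \<xi> \<and>
     (AE t in lebesgue. t \<in> {0..\<tau>} \<longrightarrow>
        (\<xi> has_vector_derivative f (\<xi> t) (u t) (w t)) (at t within {0..\<tau>}))"

text \<open>Solutions are total functions on the reals, so uniqueness can only mean equality
  on \<open>[0, \<tau>]\<close>.\<close>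

definition well_posed ::
  "(real ^ 'n \<Rightarrow> real ^ 'mu \<Rightarrow> real ^ 'mw \<Rightarrow> real ^ 'n) \<Rightarrow> real \<Rightarrow> bool" where
  "well_posed f \<tau> \<longleftrightarrow>
     (\<forall>x. \<forall>u\<in>L2_on \<tau>. \<forall>w\<in>L2_on \<tau>.
        (\<exists>\<xi>. ode_solution f \<tau> x u w \<xi>) \<and>
        (\<forall>\<xi> \<eta>. ode_solution f \<tau> x u w \<xi> \<longrightarrow> ode_solution f \<tau> x u w \<eta> \<longrightarrow>
           (\<forall>t\<in>{0..\<tau>}. \<xi> t = \<eta> t)))"

text \<open>If \<open>f\<close> is well posed on the horizon \<open>\<tau>\<close>, the values on \<open>[0, \<tau>]\<close> do not depend on
  the choice made here.\<close>

definition solution_map ::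
  "(real ^ 'n \<Rightarrow> real ^ 'mu \<Rightarrow> real ^ 'mw \<Rightarrow> real ^ 'n) \<Rightarrow> real \<Rightarrow> real ^ 'n \<Rightarrow>
   (real \<Rightarrow> real ^ 'mu) \<Rightarrow> (real \<Rightarrow> real ^ 'mw) \<Rightarrow> real \<Rightarrow> real ^ 'n" where
  "solution_map f \<tau> x u w = (SOME \<xi>. ode_solution f \<tau> x u w \<xi>)"

definition FR ::
  "(real ^ 'n) set \<Rightarrow> (real ^ 'n \<Rightarrow> real ^ 'mu \<Rightarrow> real ^ 'mw \<Rightarrow> real ^ 'n) \<Rightarrow>
   real \<Rightarrow> (real ^ 'mu) set \<Rightarrow> real \<Rightarrow> (real ^ 'n) set" where
  "FR X0 f \<tau> Y \<gamma> =
     (if \<tau> = 0 then X0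
      else {y. \<exists>x\<in>X0. \<exists>u\<in>input_U \<tau> Y. \<exists>w\<in>input_W \<tau> \<gamma>. solution_map f \<tau> x u w \<tau> = y})"

definition partial_t :: "((real ^ 'n) \<times> real \<Rightarrow> real) \<Rightarrow> real ^ 'n \<Rightarrow> real \<Rightarrow> real" where
  "partial_t V x t = deriv (\<lambda>s. V (x, s)) t"

definition grad_x :: "((real ^ 'n) \<times> real \<Rightarrow> real) \<Rightarrow> real ^ 'n \<Rightarrow> real \<Rightarrow> real ^ 'n" where
  "grad_x V x t = (\<chi> i. deriv (\<lambda>h. V (x + h *\<^sub>R axis i 1, t)) 0)"

end

theory Submission
  imports Defs
begin

text \<open>
  Along a solution \<open>\<xi>\<close> put \<open>G t = V (\<xi> t, t)\<close>. Almost everywhere the chain rule and the hypothesis on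
  \<open>V\<close> give \<open>G' \<le> w \<bullet> w\<close>, so \<open>G T - G 0\<close> should be at most the integral of \<open>w \<bullet> w\<close>. Since \<open>V\<close> is only
  differentiable, hence perhaps not locally Lipschitz, \<open>G\<close> need not be absolutely continuous, and
  the exceptional null set \<open>Z\<close> has to be controlled by hand. At each \<open>t \<in> Z\<close> differentiability of
  \<open>V\<close> bounds \<open>\<bar>G s - G t\<bar>\<close> for \<open>s\<close> near \<open>t\<close> by a multiple \<open>N t\<close> of the displacement of the curve
  \<open>s \<mapsto> (\<xi> s, s)\<close>. In a sufficiently fine tagged division the intervals with tag in \<open>Z\<close> and \<open>N t = m\<close>
  lie in an open set so small that, by absolute continuity of the curve, their total contribution
  to \<open>G T - G 0\<close> is at most \<open>\<epsilon> / 2 ^ (m + 1)\<close>; the remaining intervals contribute at most a Riemann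
  sum of \<open>w \<bullet> w\<close> plus \<open>\<epsilon> * T\<close>.
\<close>

section \<open>Variation of an absolutely continuous curve near a null set\<close>

lemma abs_cont_onE:
  assumes "abs_cont_on a b \<xi>" and "\<epsilon> > 0"
  obtains \<delta> where "\<delta> > 0" "\<forall>D. finite D \<longrightarrow>
        (\<forall>(s, t)\<in>D. a \<le> s \<and> s \<le> t \<and> t \<le> b) \<longrightarrow>
        disjoint_family_on (\<lambda>(s, t). {s<..<t}) D \<longrightarrow>
        (\<Sum>(s, t)\<in>D. t - s) < \<delta> \<longrightarrow>
        (\<Sum>(s, t)\<in>D. norm (\<xi> t - \<xi> s)) < \<epsilon>"
  using assms unfolding abs_cont_on_def by blast

text \<open>By outer regularity the null set has an open superset of measure below the \<delta> of
  absolute continuity, and disjoint intervals inside it have total length below \<delta>. The index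
  type is arbitrary so that the members of a tagged division can serve as indices.\<close>

lemma abs_cont_on_null_cover:
  fixes \<xi> :: "real \<Rightarrow> 'a::real_normed_vector"
  assumes ac: "abs_cont_on a b \<xi>" and Z: "negligible Z" and "\<eta> > 0"
  obtains U where "open U" "Z \<subseteq> U"
    "\<And>(I :: 'i set) s t. finite I \<Longrightarrow> (\<And>i. i \<in> I \<Longrightarrow> a \<le> s i \<and> s i \<le> t i \<and> t i \<le> b) \<Longrightarrow>
       disjoint_family_on (\<lambda>i. {s i<..<t i}) I \<Longrightarrow> (\<And>i. i \<in> I \<Longrightarrow> {s i<..<t i} \<subseteq> U) \<Longrightarrow>
       (\<Sum>i\<in>I. norm (\<xi> (t i) - \<xi> (s i))) < \<eta>"
proof -
  obtain \<delta> where "\<delta> > 0" and \<delta>: "\<forall>D. finite D \<longrightarrow>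
        (\<forall>(s, t)\<in>D. a \<le> s \<and> s \<le> t \<and> t \<le> b) \<longrightarrow>
        disjoint_family_on (\<lambda>(s, t). {s<..<t}) D \<longrightarrow>
        (\<Sum>(s, t)\<in>D. t - s) < \<delta> \<longrightarrow>
        (\<Sum>(s, t)\<in>D. norm (\<xi> t - \<xi> s)) < \<eta>"
    using ac \<open>\<eta> > 0\<close> by (rule abs_cont_onE)
  have "Z \<in> sets lebesgue"
    using Z by (rule negligible_imp_sets)
  then obtain U where U: "open U" "Z \<subseteq> U" "U - Z \<in> lmeasurable" "emeasure lebesgue (U - Z) < \<delta>"
    using sets_lebesgue_outer_open \<open>\<delta> > 0\<close> by blast
  have "emeasure lebesgue U = emeasure lebesgue (U - Z)"
    using Z U(1) by (metis emeasure_Diff_null_set negligible_iff_null_sets borel_open lborelD sets_completionI_sets sets_lborel)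
  with U have em: "emeasure lebesgue U < \<delta>" by simp
  show thesis
  proof (rule that[OF U(1,2)])
    fix I :: "'i set" and s t
    assume fin: "finite I" and ord: "\<And>i. i \<in> I \<Longrightarrow> a \<le> s i \<and> s i \<le> t i \<and> t i \<le> b"
      and disj: "disjoint_family_on (\<lambda>i. {s i<..<t i}) I" and sub: "\<And>i. i \<in> I \<Longrightarrow> {s i<..<t i} \<subseteq> U"
    \<comment> \<open>\<open>abs_cont_on\<close> speaks of sets of pairs; only nondegenerate intervals give distinct pairs.\<close>
    define J where "J = {i\<in>I. s i < t i}"
    have finJ: "finite J" using fin by (simp add: J_def)
    have disjJ: "{s i<..<t i} \<inter> {s j<..<t j} = {}" if "i \<in> J" "j \<in> J" "i \<noteq> j" for i j
      using disj that by (auto simp: J_def disjoint_family_on_def)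
    have inj: "inj_on (\<lambda>i. (s i, t i)) J"
    proof (rule inj_onI, rule ccontr)
      fix i j assume "i \<in> J" "j \<in> J" "(s i, t i) = (s j, t j)" "i \<noteq> j"
      with disjJ[of i j] show False by (auto simp: J_def)
    qed
    have "ennreal (\<Sum>i\<in>J. t i - s i) = (\<Sum>i\<in>J. emeasure lebesgue {s i<..<t i})"
      by (subst sum_ennreal[symmetric]) (auto simp: J_def)
    also have "\<dots> = emeasure lebesgue (\<Union>i\<in>J. {s i<..<t i})"
      using finJ disjJ by (intro sum_emeasure) (auto simp: disjoint_family_on_def)
    also have "\<dots> \<le> emeasure lebesgue U"
      using sub U(1) by (intro emeasure_mono) (auto simp: J_def)
    also have "\<dots> < \<delta>" by (rule em)
    finally have len: "(\<Sum>i\<in>J. t i - s i) < \<delta>"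
      by (metis ennreal_leI not_le)
    let ?D = "(\<lambda>i. (s i, t i)) ` J"
    have "(\<Sum>(s, t)\<in>?D. norm (\<xi> t - \<xi> s)) < \<eta>"
    proof (rule \<delta>[rule_format])
      show "disjoint_family_on (\<lambda>(s, t). {s<..<t}) ?D"
        using disjJ unfolding disjoint_family_on_def by fastforce
      show "(\<Sum>(s, t)\<in>?D. t - s) < \<delta>"
        using len by (subst sum.reindex[OF inj]) auto
    qed (use finJ ord in \<open>auto simp: J_def\<close>)
    then have "(\<Sum>i\<in>J. norm (\<xi> (t i) - \<xi> (s i))) < \<eta>"
      by (subst (asm) sum.reindex[OF inj]) auto
    moreover have "(\<Sum>i\<in>J. norm (\<xi> (t i) - \<xi> (s i))) = (\<Sum>i\<in>I. norm (\<xi> (t i) - \<xi> (s i)))"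
      using fin ord by (intro sum.mono_neutral_left) (fastforce simp: J_def not_less)+
    ultimately show "(\<Sum>i\<in>I. norm (\<xi> (t i) - \<xi> (s i))) < \<eta>" by simp
  qed
qed

lemma disjoint_family_on_shrink:
  "disjoint_family_on A I \<Longrightarrow> (\<And>i. i \<in> I \<Longrightarrow> B i \<subseteq> A i) \<Longrightarrow> disjoint_family_on B I"
  unfolding disjoint_family_on_def by blast

lemma tagged_division_of_realE:
  fixes a b :: real
  assumes "p tagged_division_of {a..b}" "(x, K) \<in> p"
  obtains u v where "K = {u..v}" "a \<le> u" "u \<le> x" "x \<le> v" "v \<le> b" "Inf K = u" "Sup K = v"
proof -
  obtain u v where K: "K = cbox u v" using tagged_division_ofD(4)[OF assms] by blast
  moreover have "x \<in> K" "K \<subseteq> {a..b}" using tagged_division_ofD(2,3)[OF assms] by blast+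
  ultimately show thesis using that[of u v] by auto
qed

text \<open>Intervals are split at their tags because the estimates available on \<open>Z\<close>
  compare values only with the value at the tag. The right pieces form one disjoint family and the
  left pieces another; each gets half of \<eta>. Allowing any subset \<open>q\<close> of a division
  permits application to a single class of tags, and the existential form permits choosing
  \<open>U\<close> for a whole sequence of tolerances at once.\<close>

lemma abs_cont_on_tagged_null_cover:
  fixes \<xi> :: "real \<Rightarrow> 'a::real_normed_vector"
  assumes ac: "abs_cont_on a b \<xi>" and Z: "negligible Z" and "\<eta> > 0"
  shows "\<exists>U. open U \<and> Z \<subseteq> U \<and> (\<forall>p q. p tagged_division_of {a..b} \<and> q \<subseteq> p \<and> (\<forall>(x, K)\<in>q. K \<subseteq> U) \<longrightarrow>
       (\<Sum>(x, K)\<in>q. norm (\<xi> (Sup K) - \<xi> x) + norm (\<xi> x - \<xi> (Inf K))) < \<eta>)"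
proof -
  have "\<eta> / 2 > 0" using \<open>\<eta> > 0\<close> by simp
  then show ?thesis
  proof (rule abs_cont_on_null_cover[OF ac Z])
    fix U assume U: "open U" "Z \<subseteq> U"
      and small: "\<And>(I :: (real \<times> real set) set) s t. finite I \<Longrightarrow>
       (\<And>i. i \<in> I \<Longrightarrow> a \<le> s i \<and> s i \<le> t i \<and> t i \<le> b) \<Longrightarrow>
       disjoint_family_on (\<lambda>i. {s i<..<t i}) I \<Longrightarrow> (\<And>i. i \<in> I \<Longrightarrow> {s i<..<t i} \<subseteq> U) \<Longrightarrow>
       (\<Sum>i\<in>I. norm (\<xi> (t i) - \<xi> (s i))) < \<eta> / 2"
    show ?thesis
    proof (intro exI[of _ U] conjI U allI impI, elim conjE)
      fix p q assume p: "p tagged_division_of {a..b}" and "q \<subseteq> p" and KU: "\<forall>(x, K)\<in>q. K \<subseteq> U"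
      have fin: "finite q"
        using tagged_division_ofD(1)[OF p] \<open>q \<subseteq> p\<close> finite_subset by blast
      have q: "\<exists>u v. snd i = {u..v} \<and> a \<le> u \<and> u \<le> fst i \<and> fst i \<le> v \<and> v \<le> b \<and> Inf (snd i) = u \<and> Sup (snd i) = v"
        if "i \<in> q" for i
        using tagged_division_of_realE[OF p, of "fst i" "snd i"] that \<open>q \<subseteq> p\<close> by (metis prod.collapse subsetD)
      have disj: "disjoint_family_on (\<lambda>i. {Inf (snd i)<..<Sup (snd i)}) q"
        unfolding disjoint_family_on_def
      proof (intro ballI impI)
        fix i j assume ij: "i \<in> q" "j \<in> q" "i \<noteq> j"
        have "interior (snd i) \<inter> interior (snd j) = {}"
          using tagged_division_ofD(5)[OF p, of "fst i" "snd i" "fst j" "snd j"] ij \<open>q \<subseteq> p\<close> by auto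
        moreover have "interior (snd i) = {Inf (snd i)<..<Sup (snd i)}"
          "interior (snd j) = {Inf (snd j)<..<Sup (snd j)}"
          using q[OF ij(1)] q[OF ij(2)] by (metis interior_atLeastAtMost_real)+
        ultimately show "{Inf (snd i)<..<Sup (snd i)} \<inter> {Inf (snd j)<..<Sup (snd j)} = {}"
          by simp
      qed
      have bnd: "a \<le> Inf (snd i) \<and> Inf (snd i) \<le> fst i \<and> fst i \<le> Sup (snd i) \<and> Sup (snd i) \<le> b"
        "{Inf (snd i)..Sup (snd i)} \<subseteq> U" if "i \<in> q" for i
        using q[OF that] KU that by (auto simp: case_prod_unfold)
      have "(\<Sum>i\<in>q. norm (\<xi> (Sup (snd i)) - \<xi> (fst i))) < \<eta> / 2"
      proof (rule small[OF fin])
        show "disjoint_family_on (\<lambda>i. {fst i<..<Sup (snd i)}) q"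
          using disj by (rule disjoint_family_on_shrink) (auto dest: bnd(1))
        show "a \<le> fst i \<and> fst i \<le> Sup (snd i) \<and> Sup (snd i) \<le> b" if "i \<in> q" for i
          using bnd(1)[OF that] by linarith
        show "{fst i<..<Sup (snd i)} \<subseteq> U" if "i \<in> q" for i
          using bnd(1)[OF that] by (intro order_trans[OF _ bnd(2)[OF that]]) auto
      qed
      moreover have "(\<Sum>i\<in>q. norm (\<xi> (fst i) - \<xi> (Inf (snd i)))) < \<eta> / 2"
      proof (rule small[OF fin])
        show "disjoint_family_on (\<lambda>i. {Inf (snd i)<..<fst i}) q"
          using disj by (rule disjoint_family_on_shrink) (auto dest: bnd(1))
        show "a \<le> Inf (snd i) \<and> Inf (snd i) \<le> fst i \<and> fst i \<le> b" if "i \<in> q" for i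
          using bnd(1)[OF that] by linarith
        show "{Inf (snd i)<..<fst i} \<subseteq> U" if "i \<in> q" for i
          using bnd(1)[OF that] by (intro order_trans[OF _ bnd(2)[OF that]]) auto
      qed
      ultimately show "(\<Sum>(x, K)\<in>q. norm (\<xi> (Sup K) - \<xi> x) + norm (\<xi> x - \<xi> (Inf K))) < \<eta>"
        by (simp add: sum.distrib case_prod_unfold)
    qed
  qed
qed

section \<open>Bounding an increment by an integral, with an exceptional null set\<close>

lemma sum_half_powers_le: "finite M \<Longrightarrow> (\<Sum>m\<in>M. (1/2::real) ^ Suc m) \<le> 1"
  using sum_le_suminf[OF sums_summable[OF power_half_series], of M] sums_unique[OF power_half_series]
  by simp

text \<open>Near \<open>p\<close> the remainder is at most \<open>norm (q - p)\<close>, so a bound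
  \<open>C\<close> for the derivative yields \<open>B = C + 1\<close>. Both \<open>B\<close> and
  \<open>r\<close> depend on \<open>p\<close> and only increments from \<open>p\<close> are
  controlled, which is weaker than a local Lipschitz condition.\<close>

lemma differentiable_at_imp_pointwise_lipschitz:
  fixes \<Phi> :: "'a::real_normed_vector \<Rightarrow> 'b::real_normed_vector"
  assumes "\<Phi> differentiable (at p)"
  obtains B r where "r > 0" "\<And>q. norm (q - p) < r \<Longrightarrow> norm (\<Phi> q - \<Phi> p) \<le> B * norm (q - p)"
proof -
  obtain L where "bounded_linear L" and L: "\<And>e. e > 0 \<Longrightarrow>
      \<exists>d>0. \<forall>q. norm (q - p) < d \<longrightarrow> norm (\<Phi> q - \<Phi> p - L (q - p)) \<le> e * norm (q - p)"
    using assms unfolding differentiable_def has_derivative_at_alt by blast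
  obtain C where C: "\<And>y. norm (L y) \<le> norm y * C"
    using bounded_linear.bounded[OF \<open>bounded_linear L\<close>] by blast
  obtain r where "r > 0" and r: "\<And>q. norm (q - p) < r \<Longrightarrow> norm (\<Phi> q - \<Phi> p - L (q - p)) \<le> norm (q - p)"
    using L[of 1] by auto
  show thesis
  proof (rule that[OF \<open>r > 0\<close>])
    fix q assume "norm (q - p) < r"
    from r[OF this] C[of "q - p"] norm_triangle_sub[of "\<Phi> q - \<Phi> p" "L (q - p)"]
    show "norm (\<Phi> q - \<Phi> p) \<le> (C + 1) * norm (q - p)"
      by (simp add: algebra_simps)
  qed
qed

text \<open>One-sided straddle lemma: since \<open>t\<close> lies between \<open>u\<close> and
  \<open>v\<close>, the errors \<open>\<epsilon> * (v - t)\<close> and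
  \<open>\<epsilon> * (t - u)\<close> add up to exactly \<open>\<epsilon> * (v - u)\<close>.\<close>

lemma derivative_le_imp_increment_le:
  fixes G :: "real \<Rightarrow> real"
  assumes D: "(G has_real_derivative D) (at t within {a..b})" and "D \<le> c" and "\<epsilon> > 0"
  obtains r where "r > 0"
    "\<And>u v. a \<le> u \<Longrightarrow> u \<le> t \<Longrightarrow> t \<le> v \<Longrightarrow> v \<le> b \<Longrightarrow> t - u < r \<Longrightarrow> v - t < r \<Longrightarrow>
       G v - G u \<le> (c + \<epsilon>) * (v - u)"
proof -
  obtain r where "r > 0" and r: "\<And>y. y \<in> {a..b} \<Longrightarrow> \<bar>y - t\<bar> < r \<Longrightarrow>
      \<bar>G y - G t - D * (y - t)\<bar> \<le> \<epsilon> * \<bar>y - t\<bar>"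
    using D \<open>\<epsilon> > 0\<close> unfolding has_field_derivative_def has_derivative_within_alt real_norm_def by blast
  show thesis
  proof (rule that[OF \<open>r > 0\<close>])
    fix u v assume uv: "a \<le> u" "u \<le> t" "t \<le> v" "v \<le> b" "t - u < r" "v - t < r"
    have "G v - G t - D * (v - t) \<le> \<epsilon> * (v - t)" "D * (u - t) - (G u - G t) \<le> \<epsilon> * (t - u)"
      using r[of u] r[of v] uv by auto
    then have "G v - G u \<le> (D + \<epsilon>) * (v - u)"
      by (simp add: algebra_simps)
    also have "\<dots> \<le> (c + \<epsilon>) * (v - u)"
      using \<open>D \<le> c\<close> uv by (intro mult_right_mono) auto
    finally show "G v - G u \<le> (c + \<epsilon>) * (v - u)" .
  qed
qed

text \<open>The curve \<xi> enters only at points of \<open>Z\<close>, where it measures how fast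
  \<open>G\<close> can vary. The gauge integral suits the argument because a gauge may depend on the
  tag, so the radii, which are not uniform in \<open>t\<close>, need no uniform lower bound.\<close>

lemma increment_le_integral:
  fixes G h :: "real \<Rightarrow> real" and \<xi> :: "real \<Rightarrow> 'a::real_normed_vector"
  assumes "a \<le> b" and ac: "abs_cont_on a b \<xi>" and Z: "negligible Z" and int: "(h has_integral I) {a..b}"
    and deriv: "\<And>t. t \<in> {a..b} - Z \<Longrightarrow> \<exists>D\<le>h t. (G has_real_derivative D) (at t within {a..b})"
    and lip: "\<And>t. t \<in> {a..b} \<inter> Z \<Longrightarrow> \<exists>B. \<exists>r>0. \<forall>s\<in>{a..b}. \<bar>s - t\<bar> < r \<longrightarrow>
                \<bar>G s - G t\<bar> \<le> B * norm (\<xi> s - \<xi> t)"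
  shows "G b - G a \<le> I"
proof -
  \<comment> \<open>The slack consists of \<epsilon> from the Riemann sum, \<epsilon> from the
    intervals tagged in \<open>Z\<close>, and \<open>\<epsilon> * (b - a)\<close> from the
    derivative estimates.\<close>
  have main: "G b - G a \<le> I + \<epsilon> * (2 + (b - a))" if "\<epsilon> > 0" for \<epsilon> :: real
  proof -
    \<comment> \<open>Setting the integrand to zero on the null set keeps the integral and removes
      the intervals tagged in \<open>Z\<close> from the Riemann sum.\<close>
    define h' where "h' t = (if t \<in> Z then 0 else h t)" for t
    have "(h' has_integral I) {a..b}"
      using has_integral_spike[OF Z _ int, of h'] by (auto simp: h'_def)
    then have "\<exists>\<gamma>. gauge \<gamma> \<and> (\<forall>p. p tagged_division_of {a..b} \<and> \<gamma> fine p \<longrightarrow>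
        norm ((\<Sum>(x, K)\<in>p. measure lborel K *\<^sub>R h' x) - I) < \<epsilon>)"
      unfolding has_integral_real using \<open>\<epsilon> > 0\<close> by (elim allE impE)
    then obtain \<gamma> where "gauge \<gamma>" and \<gamma>: "\<forall>p. p tagged_division_of {a..b} \<and> \<gamma> fine p \<longrightarrow>
        \<bar>(\<Sum>(x, K)\<in>p. measure lborel K * h' x) - I\<bar> < \<epsilon>"
      unfolding real_scaleR_def real_norm_def by (elim exE conjE)
    \<comment> \<open>Rounding the constants up to natural numbers splits \<open>Z\<close> into
      countably many classes, to which summable tolerances can be assigned.\<close>
    have "\<exists>N::nat. \<exists>r>0. \<forall>s\<in>{a..b}. \<bar>s - t\<bar> < r \<longrightarrow> \<bar>G s - G t\<bar> \<le> N * norm (\<xi> s - \<xi> t)"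
      if t: "t \<in> {a..b} \<inter> Z" for t
    proof -
      obtain B r where "r > 0" and r: "\<And>s. s \<in> {a..b} \<Longrightarrow> \<bar>s - t\<bar> < r \<Longrightarrow> \<bar>G s - G t\<bar> \<le> B * norm (\<xi> s - \<xi> t)"
        using lip[OF t] by blast
      obtain N :: nat where "B \<le> N" using real_arch_simple by blast
      then have "B * norm (\<xi> s - \<xi> t) \<le> N * norm (\<xi> s - \<xi> t)" for s
        by (intro mult_right_mono) auto
      with r \<open>r > 0\<close> show ?thesis by (meson order_trans)
    qed
    then obtain N :: "real \<Rightarrow> nat" and rz where rz: "\<And>t. t \<in> {a..b} \<inter> Z \<Longrightarrow> rz t > 0"
      and N: "\<And>t s. t \<in> {a..b} \<inter> Z \<Longrightarrow> s \<in> {a..b} \<Longrightarrow> \<bar>s - t\<bar> < rz t \<Longrightarrow> \<bar>G s - G t\<bar> \<le> N t * norm (\<xi> s - \<xi> t)"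
      by metis
    have "\<exists>r>0. \<forall>u v. a \<le> u \<longrightarrow> u \<le> t \<longrightarrow> t \<le> v \<longrightarrow> v \<le> b \<longrightarrow> t - u < r \<longrightarrow> v - t < r \<longrightarrow>
       G v - G u \<le> (h t + \<epsilon>) * (v - u)" if t: "t \<in> {a..b} - Z" for t
      using deriv[OF t] derivative_le_imp_increment_le[OF _ _ \<open>\<epsilon> > 0\<close>, of G _ t a b "h t"] by metis
    then obtain rd where rd: "\<And>t. t \<in> {a..b} - Z \<Longrightarrow> rd t > 0"
      and incr: "\<And>t u v. t \<in> {a..b} - Z \<Longrightarrow> a \<le> u \<Longrightarrow> u \<le> t \<Longrightarrow> t \<le> v \<Longrightarrow> v \<le> b \<Longrightarrow>
          t - u < rd t \<Longrightarrow> v - t < rd t \<Longrightarrow> G v - G u \<le> (h t + \<epsilon>) * (v - u)"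
      by metis
    \<comment> \<open>Multiplied by the class constant \<open>m\<close>, this is at most
      \<open>\<epsilon> * (1/2) ^ Suc m\<close>, which sums to at most \<epsilon>. The
      \<open>+ 1\<close> avoids division by zero in class 0.\<close>
    define \<eta> where "\<eta> m = \<epsilon> * (1/2) ^ Suc m / (real m + 1)" for m
    have \<eta>: "\<eta> m > 0" for m using \<open>\<epsilon> > 0\<close> by (simp add: \<eta>_def)
    have "\<exists>U. \<forall>m. open (U m) \<and> Z \<subseteq> U m \<and>
        (\<forall>p q. p tagged_division_of {a..b} \<and> q \<subseteq> p \<and> (\<forall>(x, K)\<in>q. K \<subseteq> U m) \<longrightarrow>
          (\<Sum>(x, K)\<in>q. norm (\<xi> (Sup K) - \<xi> x) + norm (\<xi> x - \<xi> (Inf K))) < \<eta> m)"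
      (is "\<exists>U. ?cover U")
      by (intro choice allI abs_cont_on_tagged_null_cover ac Z \<eta>)
    then obtain U where U: "?cover U"
      by (elim exE)
    \<comment> \<open>The factor \<open>\<gamma> t\<close> controls the Riemann sum, the balls make
      the local estimate at the tag applicable, and \<open>U (N t)\<close> confines the intervals
      tagged in \<open>Z\<close> to the small open set of their class.\<close>
    define g where "g t = \<gamma> t \<inter> (if t \<in> {a..b} then
        if t \<in> Z then ball t (rz t) \<inter> U (N t) else ball t (rd t) else UNIV)" for t
    have "gauge g"
      using \<open>gauge \<gamma>\<close> rz rd U by (auto simp: gauge_def g_def intro!: open_Int)
    then obtain p where p: "p tagged_division_of {a..b}" and fine: "g fine p"
      by (rule fine_division_exists_real)
    note finp = tagged_division_ofD(1)[OF p]
    define var where "var = (\<lambda>(x, K). norm (\<xi> (Sup K) - \<xi> x) + norm (\<xi> x - \<xi> (Inf K)))"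
    define pz where "pz = {i\<in>p. fst i \<in> Z}"
    \<comment> \<open>One bound serves both kinds of tag: on \<open>Z\<close> the term with
      \<open>h'\<close> vanishes and the \<epsilon> term is nonnegative; off \<open>Z\<close> the
      straddle estimate applies.\<close>
    have step: "G (Sup K) - G (Inf K) \<le> measure lborel K * h' x + \<epsilon> * measure lborel K +
        (if x \<in> Z then N x * var (x, K) else 0)" and KU: "x \<in> Z \<Longrightarrow> K \<subseteq> U (N x)" if xK: "(x, K) \<in> p" for x K
    proof -
      obtain u v where uv: "K = {u..v}" "a \<le> u" "u \<le> x" "x \<le> v" "v \<le> b" "Inf K = u" "Sup K = v"
        using tagged_division_of_realE[OF p xK] .
      have gK: "K \<subseteq> g x" using fine xK by (auto simp: fine_def)
      have x: "x \<in> {a..b}" using uv by auto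
      have ends: "u \<in> g x" "v \<in> g x" using gK uv by auto
      show "x \<in> Z \<Longrightarrow> K \<subseteq> U (N x)"
        using gK x by (auto simp: g_def)
      show "G (Sup K) - G (Inf K) \<le> measure lborel K * h' x + \<epsilon> * measure lborel K +
        (if x \<in> Z then N x * var (x, K) else 0)"
      proof (cases "x \<in> Z")
        case True
        have "\<bar>G v - G x\<bar> \<le> N x * norm (\<xi> v - \<xi> x)" "\<bar>G u - G x\<bar> \<le> N x * norm (\<xi> u - \<xi> x)"
          using ends True x uv by (auto intro!: N simp: g_def dist_real_def abs_minus_commute)
        then have "G v - G u \<le> N x * var (x, K)"
          using uv by (simp add: var_def algebra_simps norm_minus_commute)
        moreover have "0 \<le> \<epsilon> * measure lborel K" using \<open>\<epsilon> > 0\<close> by simp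
        ultimately show ?thesis using True uv(6,7) by (simp add: h'_def)
      next
        case False
        then have "G v - G u \<le> (h x + \<epsilon>) * (v - u)"
          using ends x uv by (intro incr) (auto simp: g_def dist_real_def)
        moreover have "measure lborel K = v - u" using uv by simp
        ultimately show ?thesis using False uv(6,7) by (simp add: h'_def distrib_left mult.commute)
      qed
    qed
    \<comment> \<open>Grouping by the value of \<open>N\<close> puts all intervals of class
      \<open>m\<close> inside \<open>U m\<close>, so their variation sums to less than
      \<open>\<eta> m\<close>.\<close>
    have bad: "(\<Sum>i\<in>pz. N (fst i) * var i) \<le> \<epsilon>"
    proof -
      define M where "M = (\<lambda>i. N (fst i)) ` pz"
      have fin: "finite pz" "finite M" using finp by (auto simp: pz_def M_def)
      have "(\<Sum>i\<in>pz. N (fst i) * var i) = (\<Sum>m\<in>M. \<Sum>i\<in>{i\<in>pz. N (fst i) = m}. N (fst i) * var i)"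
        using fin by (intro sum.group[symmetric]) (auto simp: M_def)
      also have "\<dots> = (\<Sum>m\<in>M. real m * (\<Sum>i\<in>{i\<in>pz. N (fst i) = m}. var i))"
        by (simp add: sum_distrib_left)
      also have "\<dots> \<le> (\<Sum>m\<in>M. \<epsilon> * (1/2) ^ Suc m)"
      proof (rule sum_mono)
        fix m
        have "(\<Sum>i\<in>{i\<in>pz. N (fst i) = m}. var i) \<le> \<eta> m"
          unfolding var_def
          by (intro less_imp_le[OF U[THEN spec, THEN conjunct2, THEN conjunct2, rule_format, OF conjI, OF p]] conjI)
            (auto simp: pz_def dest: KU)
        then have "real m * (\<Sum>i\<in>{i\<in>pz. N (fst i) = m}. var i) \<le> (real m + 1) * \<eta> m"
          using \<eta>[of m] by (intro mult_mono) (auto simp: var_def case_prod_unfold intro!: sum_nonneg)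
        also have "(real m + 1) * \<eta> m = \<epsilon> * (1/2) ^ Suc m"
          unfolding \<eta>_def by (simp del: power_Suc)
        finally show "real m * (\<Sum>i\<in>{i\<in>pz. N (fst i) = m}. var i) \<le> \<epsilon> * (1/2) ^ Suc m" .
      qed
      also have "\<dots> \<le> \<epsilon>"
        using mult_left_mono[OF sum_half_powers_le[OF fin(2)], of \<epsilon>] \<open>\<epsilon> > 0\<close> by (simp add: sum_distrib_left)
      finally show ?thesis .
    qed
    have "G b - G a = (\<Sum>(x, K)\<in>p. G (Sup K) - G (Inf K))"
      using additive_tagged_division_1[OF \<open>a \<le> b\<close> p, of G] by simp
    also have "\<dots> \<le> (\<Sum>(x, K)\<in>p. measure lborel K * h' x + \<epsilon> * measure lborel K +
        (if x \<in> Z then N x * var (x, K) else 0))"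
      using step by (intro sum_mono) auto
    also have "\<dots> = (\<Sum>(x, K)\<in>p. measure lborel K * h' x) + \<epsilon> * (\<Sum>(x, K)\<in>p. measure lborel K) +
        (\<Sum>i\<in>pz. N (fst i) * var i)"
      unfolding pz_def using finp
      by (simp add: case_prod_unfold sum.distrib sum_distrib_left sum.inter_filter cong: if_cong)
    also have "(\<Sum>(x, K)\<in>p. measure lborel K) = b - a"
      using additive_content_tagged_division[of p a b] p \<open>a \<le> b\<close> by simp
    also have "(\<Sum>(x, K)\<in>p. measure lborel K * h' x) \<le> I + \<epsilon>"
    proof -
      have "\<gamma> fine p" using fine by (auto simp: fine_def g_def)
      with \<gamma> p have "\<bar>(\<Sum>(x, K)\<in>p. measure lborel K * h' x) - I\<bar> < \<epsilon>" by simp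
      then show ?thesis by linarith
    qed
    finally show ?thesis using bad by (simp add: algebra_simps)
  qed
  show ?thesis
  proof (rule field_le_epsilon)
    fix e :: real assume "e > 0"
    then show "G b - G a \<le> I + e"
      using main[of "e / (2 + (b - a))"] \<open>a \<le> b\<close> by simp
  qed
qed

section \<open>Restriction, graph and continuity of absolutely continuous curves\<close>

lemma abs_cont_on_subset:
  "abs_cont_on a b \<xi> \<Longrightarrow> a \<le> c \<Longrightarrow> d \<le> b \<Longrightarrow> abs_cont_on c d \<xi>"
  unfolding abs_cont_on_def by (smt (verit, best) case_prod_beta)

text \<open>The time components of the increments sum to the total length of the intervals, so
  requiring that length to be below \<open>\<epsilon> / 2\<close> as well suffices. The graph is the
  relevant curve because \<open>V\<close> depends on time too.\<close>

lemma abs_cont_on_graph: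
  assumes "abs_cont_on a b \<xi>"
  shows "abs_cont_on a b (\<lambda>t. (\<xi> t, t))"
  unfolding abs_cont_on_def
proof (intro allI impI)
  fix \<epsilon> :: real assume "\<epsilon> > 0"
  then have "\<epsilon> / 2 > 0" by simp
  with assms obtain \<delta> where "\<delta> > 0" and \<delta>: "\<forall>D. finite D \<longrightarrow>
        (\<forall>(s, t)\<in>D. a \<le> s \<and> s \<le> t \<and> t \<le> b) \<longrightarrow>
        disjoint_family_on (\<lambda>(s, t). {s<..<t}) D \<longrightarrow>
        (\<Sum>(s, t)\<in>D. t - s) < \<delta> \<longrightarrow>
        (\<Sum>(s, t)\<in>D. norm (\<xi> t - \<xi> s)) < \<epsilon> / 2"
    by (rule abs_cont_onE)
  show "\<exists>\<delta>>0. \<forall>D. finite D \<longrightarrow>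
        (\<forall>(s, t)\<in>D. a \<le> s \<and> s \<le> t \<and> t \<le> b) \<longrightarrow>
        disjoint_family_on (\<lambda>(s, t). {s<..<t}) D \<longrightarrow>
        (\<Sum>(s, t)\<in>D. t - s) < \<delta> \<longrightarrow>
        (\<Sum>(s, t)\<in>D. norm ((\<xi> t, t) - (\<xi> s, s))) < \<epsilon>"
  proof (intro exI[of _ "min \<delta> (\<epsilon> / 2)"] conjI allI impI)
    fix D assume D: "finite D" "\<forall>(s, t)\<in>D. a \<le> s \<and> s \<le> t \<and> t \<le> b"
      "disjoint_family_on (\<lambda>(s, t). {s<..<t}) D" "(\<Sum>(s, t)\<in>D. t - s) < min \<delta> (\<epsilon> / 2)"
    have "(\<Sum>(s, t)\<in>D. norm ((\<xi> t, t) - (\<xi> s, s))) \<le> (\<Sum>(s, t)\<in>D. norm (\<xi> t - \<xi> s) + (t - s))"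
    proof (intro sum_mono, clarify)
      fix s t assume "(s, t) \<in> D"
      then show "norm ((\<xi> t, t) - (\<xi> s, s)) \<le> norm (\<xi> t - \<xi> s) + (t - s)"
        using D(2) norm_Pair_le[of "\<xi> t - \<xi> s" "t - s"] by auto
    qed
    also have "\<dots> = (\<Sum>(s, t)\<in>D. norm (\<xi> t - \<xi> s)) + (\<Sum>(s, t)\<in>D. t - s)"
      by (simp add: case_prod_unfold sum.distrib)
    also have "\<dots> < \<epsilon>"
    proof -
      have "(\<Sum>(s, t)\<in>D. norm (\<xi> t - \<xi> s)) < \<epsilon> / 2"
        using \<delta> D by simp
      then show ?thesis using D(4) by linarith
    qed
    finally show "(\<Sum>(s, t)\<in>D. norm ((\<xi> t, t) - (\<xi> s, s))) < \<epsilon>" .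
  qed (use \<open>\<epsilon> > 0\<close> \<open>\<delta> > 0\<close> in simp)
qed

lemma abs_cont_on_imp_continuous_on:
  assumes "abs_cont_on a b \<xi>"
  shows "continuous_on {a..b} \<xi>"
  unfolding continuous_on_iff
proof (intro ballI allI impI)
  fix x e :: real assume x: "x \<in> {a..b}" and "0 < e"
  from assms \<open>0 < e\<close> obtain \<delta> where "\<delta> > 0" and \<delta>: "\<forall>D. finite D \<longrightarrow>
        (\<forall>(s, t)\<in>D. a \<le> s \<and> s \<le> t \<and> t \<le> b) \<longrightarrow>
        disjoint_family_on (\<lambda>(s, t). {s<..<t}) D \<longrightarrow>
        (\<Sum>(s, t)\<in>D. t - s) < \<delta> \<longrightarrow>
        (\<Sum>(s, t)\<in>D. norm (\<xi> t - \<xi> s)) < e"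
    by (rule abs_cont_onE)
  have "dist (\<xi> y) (\<xi> x) < e" if "y \<in> {a..b}" "dist y x < \<delta>" for y
    \<comment> \<open>A family of one interval suffices; \<open>min\<close> and \<open>max\<close>
      put its endpoints in order.\<close>
    using \<delta>[THEN spec, of "{(min x y, max x y)}"] that x
    by (auto simp: disjoint_family_on_def dist_norm min_def max_def norm_minus_commute split: if_splits)
  with \<open>\<delta> > 0\<close> show "\<exists>d>0. \<forall>y\<in>{a..b}. dist y x < d \<longrightarrow> dist (\<xi> y) (\<xi> x) < e"
    by blast
qed

section \<open>Partial derivatives and the chain rule along a curve\<close>

lemma has_derivative_imp_partials:
  assumes V': "(V has_derivative V') (at (x, t))"
  shows "V' (v, s) = partial_t V x t * s + grad_x V x t \<bullet> v"
proof -
  interpret V': bounded_linear V' using V' by (rule has_derivative_bounded_linear)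
  \<comment> \<open>\<open>deriv\<close> is meaningful only where a derivative exists; total
    differentiability at \<open>(x, t)\<close> provides one along every coordinate line.\<close>
  have "((\<lambda>s. V (x, s)) has_derivative (\<lambda>h. V' (0, h))) (at t)"
    by (rule has_derivative_compose[where g = V and f = "\<lambda>s. (x, s)"]) (auto intro!: derivative_eq_intros simp: V')
  moreover have "(\<lambda>h. V' (0, h)) = (*) (V' (0, 1))"
  proof
    show "V' (0, h) = V' (0, 1) * h" for h
      using V'.scaleR[of h "(0, 1)"] by simp
  qed
  ultimately have t: "partial_t V x t = V' (0, 1)"
    unfolding partial_t_def by (intro DERIV_imp_deriv) (simp add: has_field_derivative_def)
  have x: "grad_x V x t $ i = V' (axis i 1, 0)" for i
  proof -
    have "((\<lambda>h. V (x + h *\<^sub>R axis i 1, t)) has_derivative (\<lambda>h. V' (h *\<^sub>R axis i 1, 0))) (at 0)"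
      by (rule has_derivative_compose[where g = V and f = "\<lambda>h. (x + h *\<^sub>R axis i 1, t)"]) (auto intro!: derivative_eq_intros simp: V')
    moreover have "(\<lambda>h. V' (h *\<^sub>R axis i 1, 0)) = (*) (V' (axis i 1, 0))"
    proof
      show "V' (h *\<^sub>R axis i 1, 0) = V' (axis i 1, 0) * h" for h
        using V'.scaleR[of h "(axis i 1, 0)"] by simp
    qed
    ultimately show ?thesis
      unfolding grad_x_def by (simp add: DERIV_imp_deriv has_field_derivative_def)
  qed
  \<comment> \<open>Expansion in the standard basis reduces \<open>V'\<close> to its values on
    coordinate directions by linearity.\<close>
  have "(v, s) = (\<Sum>i\<in>UNIV. v $ i *\<^sub>R (axis i 1, 0)) + s *\<^sub>R (0, 1)"
    using basis_expansion[of v] by (simp add: prod_eq_iff fst_sum snd_sum scalar_mult_eq_scaleR)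
  then have "V' (v, s) = (\<Sum>i\<in>UNIV. v $ i * V' (axis i 1, 0)) + s * V' (0, 1)"
    by (simp only: V'.add V'.sum V'.scaleR) simp
  then show ?thesis
    by (simp add: t x inner_vec_def mult.commute)
qed

text \<open>The graph has derivative \<open>(v, 1)\<close>, and the derivative of \<open>V\<close>
  in that direction is the left-hand side of the dissipation inequality when \<open>v\<close> is the
  value of the vector field.\<close>

lemma has_real_derivative_along_curve:
  assumes "V differentiable (at (\<xi> t, t))" and \<xi>: "(\<xi> has_vector_derivative v) (at t within S)"
  shows "((\<lambda>s. V (\<xi> s, s)) has_real_derivative partial_t V (\<xi> t) t + grad_x V (\<xi> t) t \<bullet> v) (at t within S)"
proof -
  obtain V' where V': "(V has_derivative V') (at (\<xi> t, t))"
    using assms(1) unfolding differentiable_def by blast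
  have "((\<lambda>s. (\<xi> s, s)) has_derivative (\<lambda>h. (h *\<^sub>R v, h))) (at t within S)"
    using \<xi> by (auto intro!: has_derivative_Pair simp: has_vector_derivative_def)
  from has_derivative_compose[where g = V, OF this V']
  show ?thesis
    unfolding has_field_derivative_def
    by (rule has_derivative_eq_rhs) (simp add: fun_eq_iff has_derivative_imp_partials[OF V'] algebra_simps)
qed

section \<open>Restriction of inputs and solutions to shorter horizons\<close>

lemma L2_on_mono:
  assumes "g \<in> L2_on \<tau>" "\<sigma> \<le> \<tau>"
  shows "g \<in> L2_on \<sigma>"
  using assms set_integrable_subset[of lebesgue "{0..\<tau>}" _ "{0..\<sigma>}"] by (auto simp: L2_on_def)

lemma input_U_mono: "u \<in> input_U \<tau> Y \<Longrightarrow> \<sigma> \<le> \<tau> \<Longrightarrow> u \<in> input_U \<sigma> Y"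
  by (auto simp: input_U_def intro: L2_on_mono)

lemma input_W_mono:
  assumes "w \<in> input_W \<tau> \<gamma>" "\<sigma> \<le> \<tau>"
  shows "w \<in> input_W \<sigma> \<gamma>"
proof -
  have w: "w \<in> L2_on \<tau>" "(LINT t:{0..\<tau>}|lebesgue. w t \<bullet> w t) < \<gamma>"
    using assms(1) by (auto simp: input_W_def)
  \<comment> \<open>The integrand is nonnegative, so a shorter horizon cannot increase the
    energy.\<close>
  have "(LINT t:{0..\<sigma>}|lebesgue. w t \<bullet> w t) \<le> (LINT t:{0..\<tau>}|lebesgue. w t \<bullet> w t)"
    using w(1) L2_on_mono[OF w(1) assms(2)] assms(2)
    unfolding set_lebesgue_integral_def L2_on_def set_integrable_def
    by (intro integral_mono) (auto simp: indicator_def)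
  with w L2_on_mono[OF w(1) assms(2)] show ?thesis by (simp add: input_W_def)
qed

lemma ode_solution_mono:
  assumes "ode_solution f \<tau> x u w \<xi>" "\<sigma> \<le> \<tau>"
  shows "ode_solution f \<sigma> x u w \<xi>"
  unfolding ode_solution_def
proof (intro conjI)
  show "\<xi> 0 = x" using assms(1) by (simp add: ode_solution_def)
  show "abs_cont_on 0 \<sigma> \<xi>"
    using assms abs_cont_on_subset[of 0 \<tau> \<xi> 0 \<sigma>] by (simp add: ode_solution_def)
  have "AE t in lebesgue. t \<in> {0..\<tau>} \<longrightarrow>
        (\<xi> has_vector_derivative f (\<xi> t) (u t) (w t)) (at t within {0..\<tau>})"
    using assms(1) by (simp add: ode_solution_def)
  then show "AE t in lebesgue. t \<in> {0..\<sigma>} \<longrightarrow>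
        (\<xi> has_vector_derivative f (\<xi> t) (u t) (w t)) (at t within {0..\<sigma>})"
    by eventually_elim (use assms(2) in \<open>auto intro: has_vector_derivative_within_subset\<close>)
qed

text \<open>\<open>SOME\<close> picks some solution, and uniqueness identifies it on the horizon
  with the given one.\<close>

lemma solution_map_eq:
  assumes "well_posed f \<tau>" "u \<in> L2_on \<tau>" "w \<in> L2_on \<tau>"
    and \<xi>: "ode_solution f \<tau> x u w \<xi>" and t: "t \<in> {0..\<tau>}"
  shows "solution_map f \<tau> x u w t = \<xi> t"
proof -
  have "ode_solution f \<tau> x u w (solution_map f \<tau> x u w)"
    using \<xi> unfolding solution_map_def by (rule someI[of "ode_solution f \<tau> x u w"])
  moreover have "\<forall>\<xi> \<eta>. ode_solution f \<tau> x u w \<xi> \<longrightarrow> ode_solution f \<tau> x u w \<eta> \<longrightarrow>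
      (\<forall>t\<in>{0..\<tau>}. \<xi> t = \<eta> t)"
    using assms(1-3) by (simp add: well_posed_def)
  ultimately show ?thesis using \<xi> t by blast
qed

text \<open>\<open>FR\<close> at time \<open>t\<close> uses inputs and solution maps with horizon
  \<open>t\<close>, whereas \<xi> is a solution on the horizon \<open>T\<close>. Restricting inputs
  and solution to \<open>[0, t]\<close> and using uniqueness there bridges the gap; this places the
  whole trajectory in \<open>Xc\<close>.\<close>

lemma ode_solution_in_FR:
  assumes wp: "\<And>\<tau>. 0 < \<tau> \<Longrightarrow> \<tau> \<le> T \<Longrightarrow> well_posed f \<tau>"
    and "x \<in> X0" and u: "u \<in> input_U T Y" and w: "w \<in> input_W T \<gamma>"
    and \<xi>: "ode_solution f T x u w \<xi>" and t: "t \<in> {0..T}"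
  shows "\<xi> t \<in> FR X0 f t Y \<gamma>"
proof (cases "t = 0")
  case True
  then show ?thesis using \<xi> \<open>x \<in> X0\<close> by (simp add: FR_def ode_solution_def)
next
  case False
  have ut: "u \<in> input_U t Y" and wt: "w \<in> input_W t \<gamma>" and \<xi>t: "ode_solution f t x u w \<xi>"
    using t u w \<xi> by (auto intro: input_U_mono input_W_mono ode_solution_mono)
  then have "solution_map f t x u w t = \<xi> t"
    using wp[of t] False t by (intro solution_map_eq) (auto simp: input_U_def input_W_def)
  then show ?thesis
    using False \<open>x \<in> X0\<close> ut wt by (auto simp: FR_def)
qed

section \<open>Integrating the dissipation inequality along a trajectory\<close>

theorem theorem4:
  fixes X0 Xc :: "(real ^ 'n) set"
    and f :: "real ^ 'n \<Rightarrow> real ^ 'mu \<Rightarrow> real ^ 'mw \<Rightarrow> real ^ 'n"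
    and T \<gamma> :: real
    and Y :: "(real ^ 'mu) set"
    and V :: "(real ^ 'n) \<times> real \<Rightarrow> real"
  assumes "T > 0" and "\<gamma> \<ge> 0"
    and "\<And>\<tau>. 0 < \<tau> \<Longrightarrow> \<tau> \<le> T \<Longrightarrow> well_posed f \<tau>"
    and "\<And>t. t \<in> {0..T} \<Longrightarrow> FR X0 f t Y \<gamma> \<subseteq> Xc"
    and "\<And>p. V differentiable (at p)"
    and "\<And>x. x \<in> X0 \<Longrightarrow> V (x, 0) \<le> 1"
    and "\<And>x t u w. x \<in> Xc \<Longrightarrow> t \<in> {0..T} \<Longrightarrow> u \<in> Y \<Longrightarrow>
           partial_t V x t + grad_x V x t \<bullet> f x u w \<le> w \<bullet> w"
  shows "FR X0 f T Y \<gamma> \<subseteq> {x. V (x, T) \<le> 1 + \<gamma>}"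
proof
  fix y assume "y \<in> FR X0 f T Y \<gamma>"
  then obtain x u w where x: "x \<in> X0" and u: "u \<in> input_U T Y" and w: "w \<in> input_W T \<gamma>"
    and y: "y = solution_map f T x u w T"
    using \<open>T > 0\<close> by (auto simp: FR_def)
  define \<xi> where "\<xi> = solution_map f T x u w"
  have "\<exists>\<xi>. ode_solution f T x u w \<xi>"
    using assms(3)[of T] \<open>T > 0\<close> u w by (simp add: well_posed_def input_U_def input_W_def)
  then have \<xi>: "ode_solution f T x u w \<xi>"
    unfolding \<xi>_def solution_map_def by (rule someI_ex[of "ode_solution f T x u w"])
  then have ac: "abs_cont_on 0 T \<xi>" and \<xi>0: "\<xi> 0 = x"
    by (auto simp: ode_solution_def)
  have Xc: "\<xi> t \<in> Xc" if "t \<in> {0..T}" for t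
    using ode_solution_in_FR[OF assms(3) x u w \<xi> that] assms(4)[OF that] by blast
  obtain Z where Z: "negligible Z" and ode: "\<And>t. t \<in> {0..T} - Z \<Longrightarrow>
      (\<xi> has_vector_derivative f (\<xi> t) (u t) (w t)) (at t within {0..T})"
  proof -
    have "AE t in lebesgue. t \<in> {0..T} \<longrightarrow>
        (\<xi> has_vector_derivative f (\<xi> t) (u t) (w t)) (at t within {0..T})"
      using \<xi> by (simp add: ode_solution_def)
    then obtain Z where "Z \<in> null_sets lebesgue" "{t \<in> space lebesgue. \<not> (t \<in> {0..T} \<longrightarrow>
        (\<xi> has_vector_derivative f (\<xi> t) (u t) (w t)) (at t within {0..T}))} \<subseteq> Z"
      by (auto simp: eventually_ae_filter)
    then show thesis using that[of Z] by (auto simp: negligible_iff_null_sets)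
  qed
  \<comment> \<open>The increment bound is applied with the graph of \<xi> as the curve,
    \<open>w t \<bullet> w t\<close> as the integrand, and \<open>Z\<close> containing the times in
    \<open>{0..T}\<close> at which the differential equation fails.\<close>
  have "V (\<xi> T, T) - V (\<xi> 0, 0) \<le> (LINT t:{0..T}|lebesgue. w t \<bullet> w t)"
  proof (rule increment_le_integral[where G = "\<lambda>t. V (\<xi> t, t)"])
    show "0 \<le> T" using \<open>T > 0\<close> by simp
    show "abs_cont_on 0 T (\<lambda>t. (\<xi> t, t))" using ac by (rule abs_cont_on_graph)
    show "negligible Z" by (rule Z)
    show "((\<lambda>t. w t \<bullet> w t) has_integral (LINT t:{0..T}|lebesgue. w t \<bullet> w t)) {0..T}"
      using w by (intro has_integral_set_lebesgue) (simp add: input_W_def L2_on_def)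
  next
    fix t assume t: "t \<in> {0..T} - Z"
    have "u t \<in> Y" using u t by (auto simp: input_U_def)
    then show "\<exists>D\<le>w t \<bullet> w t. ((\<lambda>t. V (\<xi> t, t)) has_real_derivative D) (at t within {0..T})"
      using has_real_derivative_along_curve[OF assms(5) ode[OF t]] assms(7) Xc t by blast
  next
    fix t assume t: "t \<in> {0..T} \<inter> Z"
    obtain B r where "r > 0" and B: "\<And>q. norm (q - (\<xi> t, t)) < r \<Longrightarrow>
        norm (V q - V (\<xi> t, t)) \<le> B * norm (q - (\<xi> t, t))"
      using differentiable_at_imp_pointwise_lipschitz[OF assms(5)] by blast
    \<comment> \<open>At a time in \<open>Z\<close> only differentiability of \<open>V\<close> is
      used; continuity of the graph turns the space-time radius \<open>r\<close> into a time radius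
      \<open>d\<close>.\<close>
    have "continuous_on {0..T} (\<lambda>t. (\<xi> t, t))"
      using ac by (intro abs_cont_on_imp_continuous_on abs_cont_on_graph)
    then obtain d where "d > 0" "\<And>s. s \<in> {0..T} \<Longrightarrow> \<bar>s - t\<bar> < d \<Longrightarrow> norm ((\<xi> s, s) - (\<xi> t, t)) < r"
      using t \<open>r > 0\<close> unfolding continuous_on_iff dist_norm real_norm_def by (meson IntD1)
    with B show "\<exists>B. \<exists>r>0. \<forall>s\<in>{0..T}. \<bar>s - t\<bar> < r \<longrightarrow>
        \<bar>V (\<xi> s, s) - V (\<xi> t, t)\<bar> \<le> B * norm ((\<xi> s, s) - (\<xi> t, t))"
      unfolding real_norm_def by blast
  qed
  then have "V (\<xi> T, T) \<le> 1 + \<gamma>"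
    using assms(6)[OF x] w \<xi>0 by (auto simp: input_W_def)
  then show "y \<in> {x. V (x, T) \<le> 1 + \<gamma>}" by (simp add: y \<xi>_def)
qed

end
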